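(* Let $\mathcal{X}$ be a set of $n\times n$ matrices over $\mathbb{R}_{\max}$ satisfying the standing assumptions (A1)–(A3) listed in the context, let $A_1,\dots,A_k\in\mathcal{X}$, and let $\Gamma(k)=A_1\otimes A_2\otimes\cdots\otimes A_k$. Suppose that, for some $i,j\in\{1,\dots,n\}$, $$k>\max\left(\frac{w_i^*+v_j^*-\gamma_{ij}}{\lambda^*}+(n-1),\ \frac{w_i^*-\alpha_i+v_j^*-\beta_j}{\lambda^*}+2(n-1)\right).$$ Then, for this pair $i,j$, $$\Gamma(k)_{i,j}=\Gamma(k)_{i,1}\otimes\Gamma(k)_{1,j}=\Gamma(k)_{i,1}+\Gamma(k)_{1,j}.$$
   Context: Max-plus algebra: $\mathbb{R}_{\max}=\mathbb{R}\cup\{-\infty\}$, $a\oplus b=\max\{a,b\}$, $a\otimes b=a+b$; for matrices, $(A\otimes B)_{i,j}=\max_{k}(a_{i,k}+b_{k,j})$. Digraphs: for $A\in\mathbb{R}_{\max}^{n\times n}$, $\mathcal{D}_A$ is the weighted digraph with nodes $N=\{1,\dots,n\}$, edge set $E_A=\{(i,j): a_{i,j}\neq-\infty\}$, and edge weights $a_{i,j}$. A walk is a sequence of nodes $(i_0,\dots,i_l)$ with consecutive pairs being edges; its length is $l$ and its weight is the sum of the weights of its edges; $(i_0)$ is a walk of length $0$ and weight $0$. A path is a walk with no repeated nodes; a cycle is a walk with $i_0=i_l$. $A$ is irreducible if $\mathcal{D}_A$ is strongly connected. $A,B$ are geometrically equivalent if $E_A=E_B$. A critical cycle of $\mathcal{D}_A$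 is an elementary cycle (no repeated node except start = end, length at least 1) whose mean weight (weight divided by length) is maximal among all cycles of $\mathcal{D}_A$. Matrix set: $\mathcal{X}$ is a nonempty (possibly infinite) set of matrices in $\mathbb{R}_{\max}^{n\times n}$; $A^{\sup}$ and $A^{\inf}$ are the entrywise supremum and infimum over $\mathcal{X}$. Standing assumptions: (A1) the matrices in $\mathcal{X}$ are irreducible and pairwise geometrically equivalent, and $A^{\inf}$ is geometrically equivalent to them; (A2) for each $X\in\mathcal{X}$, $\mathcal{D}_X$ has a unique critical cycle, namely the loop of length $1$ at node $1$, with weight $0$; (A3) $\mathcal{D}_{A^{\sup}}$ has a unique critical cycle, namely the loop of length $1$ at node $1$, with weight $0$. Trellis digraph $\mathcal{T}_{\Gamma(k)}$: nodes $i:l$ for $1\le i\le n$, $0\le l\le k$; there is an edge $(i:(l-1),\,j:l)$, $1\le l\le k$, exactly when $(A_l)_{i,j}\ne-\infty$, with weight $(A_l)_{i,j}$; there are no other edges. An initial walk connecting $i$ to $1$ is a walk on $\mathcal{T}_{\Gamma(k)}$ from $i:0$ to $1:m$ for some $0\le m\le k$ that visits copies of node $1$ only at its last node $1:m$. A final walk connecting $1$ to $j$ is a walk from $1:l$ to $j:k$ for some $0\le l\le k$ that visits copies of node $1$ only at its first node $1:l$. Parameters (maxima over empty sets are $-\infty$): $\lambda^*$ is the largest cycle mean in the submatrix $(A^{\sup}_{i,j})_{i,j\neq1}$, i.e. $\lambda^*=\max_{r\ge1}\max_{2\le i_1,\dots,i_r\le n}\frac{A^{\sup}_{i_1i_2}+\dots+A^{\sup}_{i_ri_1}}{r}$;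 $\alpha_i$ is the maximal weight of paths on $\mathcal{D}_{A^{\sup}}$ connecting $i$ to $1$; $\beta_j$ is the maximal weight of paths on $\mathcal{D}_{A^{\sup}}$ connecting $1$ to $j$; $\gamma_{ij}$ is the maximal weight of paths on $\mathcal{D}_{A^{\sup}}$ connecting $i$ to $j$ and not going through node $1$; $w_i^*$ is the maximal weight of initial walks on $\mathcal{T}_{\Gamma(k)}$ connecting $i$ to $1$; $v_j^*$ is the maximal weight of final walks on $\mathcal{T}_{\Gamma(k)}$ connecting $1$ to $j$. Conventions for degenerate values: if $\gamma_{ij}=-\infty$, the quotient containing $\gamma_{ij}$ is $-\infty$ (imposes no condition); otherwise, if $\lambda^*=-\infty$, quotients by $\lambda^*$ are $0$; otherwise a numerator equal to $-\infty$ gives a quotient $+\infty$ (since $\lambda^*<0$). *)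

theory Defs
  imports
    "HOL-Library.Extended_Real"
    "Graph_Theory.Vertex_Walk"
    "Graph_Theory.Digraph_Component"
begin

text \<open>
  An \<open>n \<times> n\<close> matrix over the max-plus semiring is a function \<open>nat \<Rightarrow> nat \<Rightarrow> ereal\<close> of which only
  the entries with indices in \<open>{1..n}\<close> matter; those entries must differ from \<open>\<infinity>\<close>
  (\<open>maxplus_matrix\<close>). Here \<open>a \<otimes> b\<close> is \<open>a + b\<close>, and maxima, including those over empty or
  infinite sets, are suprema in \<open>ereal\<close>, so that the supremum of the empty set is \<open>-\<infinity>\<close>.
\<close>

type_synonym mpmat = "nat \<Rightarrow> nat \<Rightarrow> ereal"

definition maxplus_matrix :: "nat \<Rightarrow> mpmat \<Rightarrow> bool" where
  "maxplus_matrix n A \<longleftrightarrow> (\<forall>i\<in>{1..n}. \<forall>j\<in>{1..n}. A i j \<noteq> \<infinity>)"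

definition maxplus_mult :: "nat \<Rightarrow> mpmat \<Rightarrow> mpmat \<Rightarrow> mpmat" where
  "maxplus_mult n A B = (\<lambda>i j. SUP s\<in>{1..n}. A i s + B s j)"

text \<open>\<open>maxplus_prod n A k\<close> is \<open>A 1 \<otimes> \<dots> \<otimes> A k\<close>; the empty product is the max-plus unit matrix.\<close>

primrec maxplus_prod :: "nat \<Rightarrow> (nat \<Rightarrow> mpmat) \<Rightarrow> nat \<Rightarrow> mpmat" where
  "maxplus_prod n A 0 = (\<lambda>i j. if i = j then 0 else -\<infinity>)"
| "maxplus_prod n A (Suc k) = maxplus_mult n (maxplus_prod n A k) (A (Suc k))"

definition sup_matrix :: "mpmat set \<Rightarrow> mpmat" where
  "sup_matrix \<X> = (\<lambda>i j. SUP X\<in>\<X>. X i j)"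

definition inf_matrix :: "mpmat set \<Rightarrow> mpmat" where
  "inf_matrix \<X> = (\<lambda>i j. INF X\<in>\<X>. X i j)"

definition edge_set :: "nat \<Rightarrow> mpmat \<Rightarrow> (nat \<times> nat) set" where
  "edge_set n A = {(i, j). i \<in> {1..n} \<and> j \<in> {1..n} \<and> A i j \<noteq> -\<infinity>}"

definition mat_digraph :: "nat \<Rightarrow> mpmat \<Rightarrow> (nat, nat \<times> nat) pre_digraph" where
  "mat_digraph n A = with_proj \<lparr> pverts = {1..n}, parcs = edge_set n A \<rparr>"

definition mat_irreducible :: "nat \<Rightarrow> mpmat \<Rightarrow> bool" where
  "mat_irreducible n A \<longleftrightarrow> strongly_connected (mat_digraph n A)"

definition geom_equivalent :: "nat \<Rightarrow> mpmat \<Rightarrow> mpmat \<Rightarrow> bool" where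
  "geom_equivalent n A B \<longleftrightarrow> edge_set n A = edge_set n B"

text \<open>
  Walks are the node sequences of \<^const>\<open>vwalk\<close>, paths those of \<^const>\<open>vpath\<close>; the length
  \<^const>\<open>vwalk_length\<close> counts edges.
\<close>

definition walk_weight :: "('v \<times> 'v \<Rightarrow> ereal) \<Rightarrow> 'v list \<Rightarrow> ereal" where
  "walk_weight w p = sum_list (map w (vwalk_arcs p))"

definition mat_weight :: "mpmat \<Rightarrow> nat list \<Rightarrow> ereal" where
  "mat_weight A = walk_weight (\<lambda>(i, j). A i j)"

definition cycle_mean :: "mpmat \<Rightarrow> nat list \<Rightarrow> ereal" where
  "cycle_mean A c = mat_weight A c / ereal (real (vwalk_length c))"

text \<open>Cycles of length 0 are left out, since they have no mean weight.\<close>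

definition mat_cycle :: "nat \<Rightarrow> mpmat \<Rightarrow> nat list \<Rightarrow> bool" where
  "mat_cycle n A c \<longleftrightarrow> vwalk c (mat_digraph n A) \<and> vwalk_length c \<ge> 1 \<and> hd c = last c"

definition critical_cycle :: "nat \<Rightarrow> mpmat \<Rightarrow> nat list \<Rightarrow> bool" where
  "critical_cycle n A c \<longleftrightarrow> mat_cycle n A c \<and> distinct (tl c) \<and>
     (\<forall>d. mat_cycle n A d \<longrightarrow> cycle_mean A d \<le> cycle_mean A c)"

text \<open>
  As a node sequence, the loop at node 1 is \<open>[1, 1]\<close>. It has no other cyclic rotation, so it is
  immaterial here whether rotations of a cycle are identified.
\<close>

definition unique_critical_loop_at_1 :: "nat \<Rightarrow> mpmat \<Rightarrow> bool" where
  "unique_critical_loop_at_1 n A \<longleftrightarrow> {c. critical_cycle n A c} = {[1, 1]} \<and> mat_weight A [1, 1] = 0"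

text \<open>The node \<open>i:l\<close> of the trellis digraph is the pair \<open>(i, l)\<close>.\<close>

definition trellis :: "nat \<Rightarrow> (nat \<Rightarrow> mpmat) \<Rightarrow> nat \<Rightarrow> (nat \<times> nat, (nat \<times> nat) \<times> (nat \<times> nat)) pre_digraph" where
  "trellis n A k = with_proj
     \<lparr> pverts = {1..n} \<times> {0..k},
       parcs = {((i, l - 1), (j, l)) | i j l.
                  i \<in> {1..n} \<and> j \<in> {1..n} \<and> l \<in> {1..k} \<and> A l i j \<noteq> -\<infinity>} \<rparr>"

definition trellis_weight :: "(nat \<Rightarrow> mpmat) \<Rightarrow> (nat \<times> nat) list \<Rightarrow> ereal" where
  "trellis_weight A = walk_weight (\<lambda>((i, l'), (j, l)). A l i j)"

definition initial_walk :: "nat \<Rightarrow> (nat \<Rightarrow> mpmat) \<Rightarrow> nat \<Rightarrow> nat \<Rightarrow> (nat \<times> nat) list \<Rightarrow> bool" where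
  "initial_walk n A k i p \<longleftrightarrow> vwalk p (trellis n A k) \<and> hd p = (i, 0) \<and>
     (\<exists>m\<in>{0..k}. last p = (1, m)) \<and> (\<forall>v\<in>set (butlast p). fst v \<noteq> 1)"

definition final_walk :: "nat \<Rightarrow> (nat \<Rightarrow> mpmat) \<Rightarrow> nat \<Rightarrow> nat \<Rightarrow> (nat \<times> nat) list \<Rightarrow> bool" where
  "final_walk n A k j p \<longleftrightarrow> vwalk p (trellis n A k) \<and> (\<exists>l\<in>{0..k}. hd p = (1, l)) \<and>
     last p = (j, k) \<and> (\<forall>v\<in>set (tl p). fst v \<noteq> 1)"

definition w_star :: "nat \<Rightarrow> (nat \<Rightarrow> mpmat) \<Rightarrow> nat \<Rightarrow> nat \<Rightarrow> ereal" where
  "w_star n A k i = (SUP p\<in>{p. initial_walk n A k i p}. trellis_weight A p)"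

definition v_star :: "nat \<Rightarrow> (nat \<Rightarrow> mpmat) \<Rightarrow> nat \<Rightarrow> nat \<Rightarrow> ereal" where
  "v_star n A k j = (SUP p\<in>{p. final_walk n A k j p}. trellis_weight A p)"

text \<open>
  The index sequence \<open>i\<^sub>1, \<dots>, i\<^sub>r\<close> is a nonempty list \<open>c\<close> over \<open>{2..n}\<close>, and
  \<open>c @ [hd c]\<close> is the closed sequence \<open>i\<^sub>1, \<dots>, i\<^sub>r, i\<^sub>1\<close>, of length \<open>r\<close>.
\<close>

definition lambda_star :: "nat \<Rightarrow> mpmat \<Rightarrow> ereal" where
  "lambda_star n S = (SUP c\<in>{c. c \<noteq> [] \<and> set c \<subseteq> {2..n}}. cycle_mean S (c @ [hd c]))"

definition alpha :: "nat \<Rightarrow> mpmat \<Rightarrow> nat \<Rightarrow> ereal" where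
  "alpha n S i =
     (SUP p\<in>{p. vpath p (mat_digraph n S) \<and> hd p = i \<and> last p = 1}. mat_weight S p)"

definition beta :: "nat \<Rightarrow> mpmat \<Rightarrow> nat \<Rightarrow> ereal" where
  "beta n S j =
     (SUP p\<in>{p. vpath p (mat_digraph n S) \<and> hd p = 1 \<and> last p = j}. mat_weight S p)"

definition gamma :: "nat \<Rightarrow> mpmat \<Rightarrow> nat \<Rightarrow> nat \<Rightarrow> ereal" where
  "gamma n S i j =
     (SUP p\<in>{p. vpath p (mat_digraph n S) \<and> hd p = i \<and> last p = j \<and> 1 \<notin> set p}. mat_weight S p)"

text \<open>Quotients by \<open>\<lambda>\<^sup>*\<close> (which is negative) with the conventions for degenerate values.\<close>

definition quot :: "ereal \<Rightarrow> ereal \<Rightarrow> ereal" where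
  "quot a lam = (if lam = -\<infinity> then 0 else if a = -\<infinity> then \<infinity> else a / lam)"

text \<open>
  If \<open>\<gamma>\<^sub>i\<^sub>j = -\<infinity>\<close>, the quotient containing it is \<open>-\<infinity>\<close> by convention, even when \<open>\<lambda>\<^sup>* = -\<infinity>\<close>.
\<close>

definition gamma_quot :: "ereal \<Rightarrow> ereal \<Rightarrow> ereal \<Rightarrow> ereal" where
  "gamma_quot wv g lam = (if g = -\<infinity> then -\<infinity> else quot (wv - g) lam)"

end

theory Submission
  imports Defs
begin

text \<open>
  The entry \<open>\<Gamma>(k)\<^sub>i\<^sub>j\<close> is the largest weight of a walk on the trellis from \<open>i:0\<close> to \<open>j:k\<close>. Closed
  walks at node 1 weigh at most 0, and the loop at node 1 weighs exactly 0. Hence only the part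
  of a walk before its first visit to node 1 and the part after its last visit matter, and in
  particular \<open>\<Gamma>(k)\<^sub>i\<^sub>1 = w\<^sub>i\<^sup>*\<close> and \<open>\<Gamma>(k)\<^sub>1\<^sub>j = v\<^sub>j\<^sup>*\<close> (\<open>prod_to_1_eq_w_star\<close>,
  \<open>prod_from_1_eq_v_star\<close>). It remains to see that \<open>\<Gamma>(k)\<^sub>i\<^sub>j = w\<^sub>i\<^sup>* + v\<^sub>j\<^sup>*\<close>. Walks through node 1 do
  not exceed this value (\<open>trellis_walk_through_1_weight_le\<close>); an optimal initial and an optimal
  final walk can be joined by loops, and so reach it, as soon as their lengths add up to at most
  \<open>k\<close> (\<open>initial_final_weight_le_prod\<close>).

  Two questions are left: why a walk that avoids node 1 does not exceed \<open>w\<^sub>i\<^sup>* + v\<^sub>j\<^sup>*\<close>, and why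
  optimal initial and final walks are short. One argument answers both. Removing elementary
  cycles from a walk leaves a path of at most \<open>n - 1\<close> edges (\<open>cycle_removal\<close>). If the cycles avoid
  node 1, then \<open>d\<close> removed edges weigh at most \<open>\<lambda>\<^sup>* d\<close>, so the walk weighs at most
  \<open>c + \<lambda>\<^sup>* d\<close>, where \<open>c\<close> bounds the weight of the path (\<open>walk_weight_le_path_bound\<close>). Since
  \<open>\<lambda>\<^sup>* < 0\<close>, a lower bound \<open>x\<close> on the weight gives \<open>d \<le> (x - c) / \<lambda>\<^sup>*\<close>
  (\<open>excess_length_le_quot\<close>). With \<open>c = \<gamma>\<^sub>i\<^sub>j\<close> and \<open>x = w\<^sub>i\<^sup>* + v\<^sub>j\<^sup>*\<close> this is the first term of the
  maximum that \<open>k\<close> exceeds: a walk avoiding node 1 of greater weight would be shorter than \<open>k\<close>.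
  With \<open>c = \<alpha>\<^sub>i + \<beta>\<^sub>j\<close>, for an initial and a final walk together, it is the second term.

  That \<open>\<lambda>\<^sup>*\<close> is negative (\<open>lambda_star_less_0\<close>) is itself an application of cycle removal: it
  reduces the supremum over all closed sequences to the finitely many elementary cycles, which
  are negative because the loop at node 1 is the unique critical cycle.
\<close>

section \<open>Maxima and sums of extended reals\<close>

lemma ereal_SUP_attained:
  fixes f :: "'a \<Rightarrow> ereal"
  assumes "finite X" "X \<noteq> {}"
  obtains x where "x \<in> X" "(SUP y\<in>X. f y) = f x"
proof -
  have "Max (f ` X) \<in> f ` X" using assms by (intro Max_in) auto
  then have "Sup (f ` X) \<in> f ` X" using assms by (simp add: Max_Sup)
  with that show thesis by auto
qed

lemma ereal_SUP_less_finite: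
  fixes f :: "'a \<Rightarrow> ereal"
  assumes "finite X" "-\<infinity> < b" "\<And>x. x \<in> X \<Longrightarrow> f x < b"
  shows "(SUP x\<in>X. f x) < b"
proof (cases "X = {}")
  case True
  then show ?thesis using assms(2) by (simp add: bot_ereal_def)
next
  case False
  with assms(1) obtain x where "x \<in> X" "(SUP y\<in>X. f y) = f x" by (rule ereal_SUP_attained)
  with assms(3) show ?thesis by simp
qed

lemma ereal_SUP_attained_or_bot:
  fixes f :: "'a \<Rightarrow> ereal"
  assumes "finite X" "(SUP x\<in>X. f x) \<noteq> -\<infinity>"
  obtains x where "x \<in> X" "(SUP y\<in>X. f y) = f x"
proof -
  have "X \<noteq> {}" using assms(2) by (auto simp: bot_ereal_def)
  with assms(1) that show thesis by (metis ereal_SUP_attained)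
qed

lemma sum_list_ereal_not_top: "(\<infinity>::ereal) \<notin> set xs \<Longrightarrow> sum_list xs \<noteq> \<infinity>"
  by (induction xs) auto

lemma sum_list_ereal_not_bot: "-(\<infinity>::ereal) \<notin> set xs \<Longrightarrow> sum_list xs \<noteq> -\<infinity>"
  by (induction xs) auto

lemma sum_list_ereal_bot: "(\<infinity>::ereal) \<notin> set xs \<Longrightarrow> -\<infinity> \<in> set xs \<Longrightarrow> sum_list xs = -\<infinity>"
proof (induction xs)
  case (Cons x xs)
  then have "x \<noteq> \<infinity>" "sum_list xs \<noteq> \<infinity>" using sum_list_ereal_not_top[of xs] by auto
  with Cons show ?case by (cases "x = -\<infinity>") auto
qed simp


section \<open>Removing cycles from a walk\<close>

lemma vwalk_arcs_split:
  "vwalk_arcs (xs @ y # ys) = vwalk_arcs (xs @ [y]) @ vwalk_arcs (y # ys)"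
proof (induction xs)
  case (Cons x xs)
  then show ?case by (cases xs) auto
qed simp

lemma walk_weight_split:
  "walk_weight w (xs @ y # ys) = walk_weight w (xs @ [y]) + walk_weight w (y # ys)"
  unfolding walk_weight_def by (subst vwalk_arcs_split) simp

lemma walk_weight_singleton [simp]: "walk_weight w [x] = 0"
  by (simp add: walk_weight_def)

text \<open>
  Stopping at the first repeated node makes the enclosed cycle \<open>y # ys\<close> elementary.
\<close>

lemma not_distinct_first_cycle:
  assumes "\<not> distinct p"
  obtains xs y ys zs where "p = xs @ y # ys @ y # zs" "distinct (y # ys)"
proof -
  from assms have "\<exists>xs y ys zs. p = xs @ y # ys @ y # zs \<and> distinct (y # ys)"
  proof (induction p rule: rev_induct)
    case (snoc x p)
    show ?case
    proof (cases "distinct p")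
      case True
      with snoc.prems have "x \<in> set p" by simp
      then obtain xs ys where "p = xs @ x # ys" by (meson split_list)
      with True have "p @ [x] = xs @ x # ys @ x # [] \<and> distinct (x # ys)" by auto
      then show ?thesis by blast
    next
      case False
      with snoc.IH obtain xs y ys zs where "p = xs @ y # ys @ y # zs" "distinct (y # ys)"
        by blast
      then have "p @ [x] = xs @ y # ys @ y # (zs @ [x]) \<and> distinct (y # ys)" by simp
      then show ?thesis by blast
    qed
  qed simp
  then show thesis using that by blast
qed

text \<open>
  Cut out elementary cycles until no node repeats. If every edge of such a cycle weighs at most
  \<open>\<mu>\<close> on average, then so does every removed edge. A removed cycle, listed without its
  closing node, occurs in \<open>p\<close> both without the last node of \<open>p\<close> and, in rotated form,
  without the first one; hence the cycles to be controlled lie in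
  \<open>set (butlast p) \<inter> set (tl p)\<close>. This is what lets a walk start or end at a node through which
  no bound on cycles is available.
\<close>

lemma cycle_removal:
  fixes w :: "'v \<times> 'v \<Rightarrow> ereal" and \<mu> :: ereal
  assumes "p \<noteq> []"
    and "\<And>c. c \<noteq> [] \<Longrightarrow> distinct c \<Longrightarrow> set c \<subseteq> set (butlast p) \<inter> set (tl p) \<Longrightarrow>
           walk_weight w (c @ [hd c]) \<le> \<mu> * ereal (real (length c))"
  shows "\<exists>q. q \<noteq> [] \<and> distinct q \<and> hd q = hd p \<and> last q = last p \<and> set q \<subseteq> set p \<and>
           set (vwalk_arcs q) \<subseteq> set (vwalk_arcs p) \<and> length q \<le> length p \<and>
           walk_weight w p \<le> walk_weight w q + \<mu> * ereal (real (length p - length q))"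
  using assms
proof (induction p rule: length_induct)
  case (1 p)
  show ?case
  proof (cases "distinct p")
    case True
    have "walk_weight w p \<le> walk_weight w p + \<mu> * ereal (real (length p - length p))"
      by (simp flip: zero_ereal_def)
    with True "1.prems"(1) show ?thesis by blast
  next
    case False
    then obtain xs y ys zs where p: "p = xs @ y # ys @ y # zs" and c: "distinct (y # ys)"
      by (rule not_distinct_first_cycle)
    define r where "r = xs @ y # zs"
    let ?C = "set (butlast p) \<inter> set (tl p)"
    have arcs_p: "vwalk_arcs p = vwalk_arcs (xs @ [y]) @ vwalk_arcs (y # ys @ [y]) @ vwalk_arcs (y # zs)"
      unfolding p using vwalk_arcs_split[of xs y "ys @ y # zs"] vwalk_arcs_split[of "y # ys" y zs]
      by simp
    have arcs_r: "vwalk_arcs r = vwalk_arcs (xs @ [y]) @ vwalk_arcs (y # zs)"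
      unfolding r_def by (rule vwalk_arcs_split)
    have sub: "set (butlast r) \<inter> set (tl r) \<subseteq> ?C"
      unfolding r_def p by (cases xs) (auto simp: butlast_append)
    have "set (y # ys) \<subseteq> ?C"
      unfolding p by (cases xs) (auto simp: butlast_append)
    with c "1.prems"(2)[of "y # ys"]
    have cyc: "walk_weight w (y # ys @ [y]) \<le> \<mu> * ereal (real (Suc (length ys)))" by simp
    have shorter: "length r < length p" by (simp add: r_def p)
    have "r \<noteq> []" by (simp add: r_def)
    moreover have "walk_weight w (c @ [hd c]) \<le> \<mu> * ereal (real (length c))"
      if "c \<noteq> []" "distinct c" "set c \<subseteq> set (butlast r) \<inter> set (tl r)" for c
      by (rule "1.prems"(2)[OF that(1,2) subset_trans[OF that(3) sub]])
    ultimately obtain q where q: "q \<noteq> []" "distinct q" "hd q = hd r" "last q = last r" "set q \<subseteq> set r"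
        "set (vwalk_arcs q) \<subseteq> set (vwalk_arcs r)" "length q \<le> length r"
        "walk_weight w r \<le> walk_weight w q + \<mu> * ereal (real (length r - length q))"
      using "1.IH"[rule_format, OF shorter] by blast
    have "walk_weight w p = walk_weight w r + walk_weight w (y # ys @ [y])"
      by (simp add: walk_weight_def arcs_p arcs_r ac_simps)
    also have "\<dots> \<le> (walk_weight w q + \<mu> * ereal (real (length r - length q)))
        + \<mu> * ereal (real (Suc (length ys)))"
      using q(8) cyc by (rule add_mono)
    also have "\<dots> = walk_weight w q + \<mu> * (ereal (real (length r - length q)) + ereal (real (Suc (length ys))))"
      by (simp only: ereal_right_distrib ereal_less_eq zero_ereal_def of_nat_0_le_iff add.assoc)
    also have "ereal (real (length r - length q)) + ereal (real (Suc (length ys)))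
        = ereal (real (length p - length q))"
      using q(7) by (simp add: r_def p)
    finally have "walk_weight w p \<le> walk_weight w q + \<mu> * ereal (real (length p - length q))" .
    moreover have "hd r = hd p" "last r = last p" "set r \<subseteq> set p"
      by (cases xs; auto simp: r_def p)+
    moreover have "set (vwalk_arcs r) \<subseteq> set (vwalk_arcs p)"
      unfolding arcs_r arcs_p by auto
    moreover have "length q \<le> length p"
      using le_less_trans[OF q(7) shorter] by (rule less_imp_le)
    ultimately show ?thesis
      using q(1-4) subset_trans[OF q(5)] subset_trans[OF q(6)] by (intro exI[of _ q]) simp
  qed
qed

section \<open>The digraph of a matrix whose only critical cycle is the loop at node 1\<close>

lemma vwalk_mat_digraph_iff:
  "vwalk p (mat_digraph n A) \<longleftrightarrow>
     p \<noteq> [] \<and> set p \<subseteq> {1..n} \<and> (\<forall>(i, j)\<in>set (vwalk_arcs p). A i j \<noteq> -\<infinity>)"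
  by (auto simp: vwalk_def mat_digraph_def edge_set_def dest: arcs_in_vwalk_arcs)

lemma distinct_length_le: "distinct p \<Longrightarrow> set p \<subseteq> {1..n} \<Longrightarrow> length p \<le> n"
  using card_mono[of "{1..n}" "set p"] by (simp add: distinct_card)

lemma finite_mat_paths: "finite {p. vpath p (mat_digraph n A) \<and> P p}"
proof (rule finite_subset)
  show "{p. vpath p (mat_digraph n A) \<and> P p} \<subseteq> {p. set p \<subseteq> {1..n} \<and> length p \<le> n}"
  proof clarify
    fix p assume "vpath p (mat_digraph n A)"
    then have "set p \<subseteq> {1..n}" "distinct p" by (auto simp: vpath_def vwalk_mat_digraph_iff)
    then show "set p \<subseteq> {1..n} \<and> length p \<le> n" by (simp add: distinct_length_le)
  qed
qed (simp add: finite_lists_length_le)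

text \<open>
  What is known of \<open>A\<^sup>s\<^sup>u\<^sup>p\<close>: its digraph is strongly connected, with the loop at node 1 as sole
  critical cycle.
\<close>

locale unique_loop_matrix =
  fixes n :: nat and S :: mpmat
  assumes irreducible: "mat_irreducible n S"
    and critical: "unique_critical_loop_at_1 n S"
begin

lemma critical_cycle_iff: "critical_cycle n S c \<longleftrightarrow> c = [1, 1]"
  and loop_weight: "mat_weight S [1, 1] = 0"
  using critical by (simp_all add: unique_critical_loop_at_1_def set_eq_iff)

lemma critical_loop: "critical_cycle n S [1, 1]"
  by (simp add: critical_cycle_iff)

lemma loop_mean: "cycle_mean S [1, 1] = 0"
  using loop_weight by (simp add: cycle_mean_def)

lemma one_in_nodes: "1 \<in> {1..n}"
  using critical_loop by (simp add: critical_cycle_def mat_cycle_def vwalk_mat_digraph_iff)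

lemma cycle_mean_le_0: "mat_cycle n S c \<Longrightarrow> cycle_mean S c \<le> 0"
  using critical_loop unfolding critical_cycle_def by (metis loop_mean)

lemma closed_walk_weight_le_0:
  assumes "mat_cycle n S c"
  shows "mat_weight S c \<le> 0"
proof -
  have "0 < ereal (real (vwalk_length c))"
    using assms by (auto simp: mat_cycle_def)
  then show ?thesis
    using cycle_mean_le_0[OF assms] by (simp add: cycle_mean_def ereal_divide_le_pos)
qed

lemma connecting_walk:
  assumes "u \<in> {1..n}" "v \<in> {1..n}"
  obtains p where "vpath p (mat_digraph n S)" "hd p = u" "last p = v"
proof -
  interpret wf_digraph "mat_digraph n S"
    by unfold_locales (auto simp: mat_digraph_def edge_set_def)
  have "u \<rightarrow>\<^sup>*\<^bsub>mat_digraph n S\<^esub> v"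
    using irreducible assms by (auto simp: mat_irreducible_def strongly_connected_def mat_digraph_def)
  then show thesis using that by (metis reachable_vpath_conv)
qed

text \<open>
  A supremum over infinitely many matrices could be infinite, but such an entry would lie on a
  cycle by strong connectivity, and that cycle would have mean \<open>\<infinity>\<close>.
\<close>

lemma entry_not_top:
  assumes "u \<in> {1..n}" "v \<in> {1..n}"
  shows "S u v \<noteq> \<infinity>"
proof
  assume top: "S u v = \<infinity>"
  obtain p where p: "vpath p (mat_digraph n S)" "hd p = v" "last p = u"
    using assms by (metis connecting_walk)
  then have ne: "p \<noteq> []" by (auto simp: vpath_def vwalk_def)
  have "mat_cycle n S (u # p)"
    using p top assms ne
    by (auto simp: mat_cycle_def vpath_def vwalk_mat_digraph_iff Suc_le_eq)
  moreover have "mat_weight S (u # p) = \<infinity>"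
    using ne p(2) top by (simp add: mat_weight_def walk_weight_def)
  ultimately show False using closed_walk_weight_le_0 by fastforce
qed

lemma arc_weight_not_top:
  assumes "set p \<subseteq> {1..n}"
  shows "\<infinity> \<notin> set (map (\<lambda>(i, j). S i j) (vwalk_arcs p))"
proof
  assume "\<infinity> \<in> set (map (\<lambda>(i, j). S i j) (vwalk_arcs p))"
  then obtain i j where ij: "(i, j) \<in> set (vwalk_arcs p)" "S i j = \<infinity>" by auto
  then have "i \<in> set p" "j \<in> set p" using arcs_in_vwalk_arcs by blast+
  with assms have "i \<in> {1..n}" "j \<in> {1..n}" by blast+
  with ij(2) entry_not_top show False by blast
qed

lemma mat_weight_not_top: "set p \<subseteq> {1..n} \<Longrightarrow> mat_weight S p \<noteq> \<infinity>"
  unfolding mat_weight_def walk_weight_def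
  by (rule sum_list_ereal_not_top[OF arc_weight_not_top])

lemma mat_weight_not_bot: "vwalk p (mat_digraph n S) \<Longrightarrow> mat_weight S p \<noteq> -\<infinity>"
  unfolding mat_weight_def walk_weight_def
  by (rule sum_list_ereal_not_bot) (auto simp: vwalk_mat_digraph_iff)

text \<open>
  A mean of 0 would make the cycle critical, and the only critical cycle passes through node 1.
  Index sequences that use a missing edge have mean \<open>-\<infinity>\<close>.
\<close>

lemma elementary_cycle_mean_less_0:
  assumes "c \<noteq> []" "set c \<subseteq> {2..n}" "distinct c"
  shows "cycle_mean S (c @ [hd c]) < 0"
proof -
  let ?d = "c @ [hd c]"
  have nodes: "set ?d \<subseteq> {1..n}" using assms by (cases c) auto
  show ?thesis
  proof (cases "\<forall>(i, j)\<in>set (vwalk_arcs ?d). S i j \<noteq> -\<infinity>")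
    case True
    then have cyc: "mat_cycle n S ?d"
      using nodes assms(1) by (auto simp: mat_cycle_def vwalk_mat_digraph_iff Suc_le_eq)
    have "hd ?d \<noteq> 1" using assms by (cases c) auto
    then have "\<not> critical_cycle n S ?d"
      by (auto simp: critical_cycle_iff)
    moreover have "distinct (tl ?d)" using assms by (cases c) auto
    ultimately obtain d where "mat_cycle n S d" "cycle_mean S ?d < cycle_mean S d"
      using cyc unfolding critical_cycle_def by (meson not_le)
    with cycle_mean_le_0 show ?thesis by (metis order_less_le_trans)
  next
    case False
    then have "mat_weight S ?d = -\<infinity>"
      unfolding mat_weight_def walk_weight_def
      by (intro sum_list_ereal_bot arc_weight_not_top nodes) force
    then show ?thesis using assms(1) by (simp add: cycle_mean_def)
  qed
qed

lemma cycle_weight_le_mean_bound: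
  assumes "c \<noteq> []" "cycle_mean S (c @ [hd c]) \<le> \<mu>"
  shows "walk_weight (\<lambda>(i, j). S i j) (c @ [hd c]) \<le> \<mu> * ereal (real (length c))"
  using assms by (simp add: cycle_mean_def mat_weight_def ereal_divide_le_pos mult.commute)

text \<open>
  Each single cycle mean is negative, but \<open>\<lambda>\<^sup>*\<close> is a supremum over infinitely many closed
  sequences. There are only finitely many elementary ones, and removing cycles from a closed
  walk leaves a single node, so the largest elementary mean bounds all others.
\<close>

lemma lambda_star_less_0: "lambda_star n S < 0"
proof -
  define E where "E = {c. c \<noteq> [] \<and> set c \<subseteq> {2..n} \<and> distinct c}"
  define \<mu> where "\<mu> = (SUP c\<in>E. cycle_mean S (c @ [hd c]))"
  have "finite E"
  proof (rule finite_subset)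
    have "{2..n} \<subseteq> {1..n}" by auto
    then show "E \<subseteq> {c. set c \<subseteq> {2..n} \<and> length c \<le> n}"
      unfolding E_def by (blast intro: distinct_length_le)
  qed (simp add: finite_lists_length_le)
  then have "\<mu> < 0"
    unfolding \<mu>_def by (rule ereal_SUP_less_finite) (auto simp: E_def elementary_cycle_mean_less_0)
  moreover have "lambda_star n S \<le> \<mu>"
    unfolding lambda_star_def
  proof (rule SUP_least, clarify)
    fix c :: "nat list"
    assume c: "c \<noteq> []" "set c \<subseteq> {2..n}"
    let ?d = "c @ [hd c]"
    have nodes: "set ?d \<subseteq> {2..n}" using c by (cases c) auto
    have "walk_weight (\<lambda>(i, j). S i j) (e @ [hd e]) \<le> \<mu> * ereal (real (length e))"
      if "e \<noteq> []" "distinct e" "set e \<subseteq> set (butlast ?d) \<inter> set (tl ?d)" for e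
    proof (rule cycle_weight_le_mean_bound)
      have "set e \<subseteq> set c" using that(3) unfolding butlast_snoc by blast
      then have "e \<in> E" using that(1,2) c(2) by (simp add: E_def)
      then show "cycle_mean S (e @ [hd e]) \<le> \<mu>" unfolding \<mu>_def by (rule SUP_upper)
    qed (rule that)
    then obtain q where q: "q \<noteq> []" "distinct q" "hd q = hd ?d" "last q = last ?d"
        "walk_weight (\<lambda>(i, j). S i j) ?d \<le>
           walk_weight (\<lambda>(i, j). S i j) q + \<mu> * ereal (real (length ?d - length q))"
      using cycle_removal[of ?d "\<lambda>(i, j). S i j" \<mu>] by blast
    \<comment> \<open>A path whose two ends coincide has no edge, so all the weight has been removed.\<close>
    have "q = [hd c]"
    proof (cases q)
      case (Cons x r)
      with q(3,4) c(1) have "x = hd c" "last (x # r) = hd c" by simp_all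
      with q(2) Cons show ?thesis by (metis distinct.simps(2) last_ConsR last_in_set)
    qed (use q(1) in simp)
    with q(5) c(1) show "cycle_mean S ?d \<le> \<mu>"
      by (simp add: cycle_mean_def mat_weight_def ereal_divide_le_pos mult.commute)
  qed
  ultimately show ?thesis by simp
qed

text \<open>
  The estimate behind all length bounds. The condition on node 1 allows it as first or as last
  node of the walk but not as a repeated inner one; every removed cycle then avoids node 1 and
  falls under \<open>\<lambda>\<^sup>*\<close>. The number \<open>l\<close> is the length of the path that remains.
\<close>

lemma walk_weight_le_path_bound:
  assumes walk: "vwalk p (mat_digraph n S)"
    and avoid: "1 \<notin> set (butlast p) \<inter> set (tl p)"
    and paths: "\<And>q. vpath q (mat_digraph n S) \<Longrightarrow> hd q = hd p \<Longrightarrow> last q = last p \<Longrightarrow>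
                  set q \<subseteq> set p \<Longrightarrow> mat_weight S q \<le> a"
  obtains l where "l \<le> n - 1" "l \<le> length p - 1"
    "mat_weight S p \<le> a + lambda_star n S * ereal (real (length p - 1 - l))"
proof -
  have nodes: "set p \<subseteq> {1..n}" and ne: "p \<noteq> []"
    using walk by (auto simp: vwalk_mat_digraph_iff)
  have "walk_weight (\<lambda>(i, j). S i j) (c @ [hd c]) \<le> lambda_star n S * ereal (real (length c))"
    if c: "c \<noteq> []" "set c \<subseteq> set (butlast p) \<inter> set (tl p)" for c
  proof (rule cycle_weight_le_mean_bound)
    have "set c \<subseteq> {1..n} - {1}" using c avoid nodes by (auto dest!: in_set_butlastD)
    also have "\<dots> = {2..n}" by auto
    finally show "cycle_mean S (c @ [hd c]) \<le> lambda_star n S"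
      unfolding lambda_star_def using c by (intro SUP_upper) auto
  qed (rule c)
  then obtain q where q: "q \<noteq> []" "distinct q" "hd q = hd p" "last q = last p" "set q \<subseteq> set p"
      "set (vwalk_arcs q) \<subseteq> set (vwalk_arcs p)" "length q \<le> length p"
      "mat_weight S p \<le> mat_weight S q + lambda_star n S * ereal (real (length p - length q))"
    using cycle_removal[OF ne, of "\<lambda>(i, j). S i j" "lambda_star n S"]
    unfolding mat_weight_def by blast
  have path: "vpath q (mat_digraph n S)"
    using q walk by (auto simp: vpath_def vwalk_mat_digraph_iff)
  have "length q \<le> n"
    using q(2) subset_trans[OF q(5) nodes] by (rule distinct_length_le)
  moreover have "mat_weight S p \<le> a + lambda_star n S * ereal (real (length p - length q))"
    using q(8) paths[OF path q(3,4,5)] by (meson add_right_mono order_trans)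
  moreover have "length p - 1 - (length q - 1) = length p - length q"
    using q(1) by (cases q) auto
  ultimately show thesis using q(7) by (intro that[of "length q - 1"]) auto
qed

lemma path_weight_SUP_finite:
  assumes "finite P" "P \<noteq> {}" "\<And>p. p \<in> P \<Longrightarrow> vwalk p (mat_digraph n S)"
  shows "\<bar>SUP p\<in>P. mat_weight S p\<bar> \<noteq> \<infinity>"
proof -
  obtain p where "p \<in> P" "(SUP p\<in>P. mat_weight S p) = mat_weight S p"
    using assms(1,2) by (rule ereal_SUP_attained)
  with assms(3) show ?thesis
    using mat_weight_not_bot mat_weight_not_top by (auto simp: vwalk_mat_digraph_iff)
qed

lemma alpha_finite: "u \<in> {1..n} \<Longrightarrow> \<bar>alpha n S u\<bar> \<noteq> \<infinity>"
  unfolding alpha_def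
  by (rule path_weight_SUP_finite[OF finite_mat_paths])
    (use connecting_walk[OF _ one_in_nodes] in \<open>auto simp: vpath_def\<close>)

lemma beta_finite: "u \<in> {1..n} \<Longrightarrow> \<bar>beta n S u\<bar> \<noteq> \<infinity>"
  unfolding beta_def
  by (rule path_weight_SUP_finite[OF finite_mat_paths])
    (use connecting_walk[OF one_in_nodes] in \<open>auto simp: vpath_def\<close>)

lemma gamma_not_top: "gamma n S u v \<noteq> \<infinity>"
proof (cases "{p. vpath p (mat_digraph n S) \<and> hd p = u \<and> last p = v \<and> 1 \<notin> set p} = {}")
  case True
  then show ?thesis unfolding gamma_def True by (simp add: bot_ereal_def)
next
  case False
  then have "\<bar>gamma n S u v\<bar> \<noteq> \<infinity>"
    unfolding gamma_def by (rule path_weight_SUP_finite[OF finite_mat_paths]) (auto simp: vpath_def)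
  then show ?thesis by auto
qed

end

section \<open>Walks on the trellis and the matrix product\<close>

lemma trellis_arcs [simp]:
  "((i, l), (j, m)) \<in> arcs_ends (trellis n A k) \<longleftrightarrow>
     i \<in> {1..n} \<and> j \<in> {1..n} \<and> m = Suc l \<and> m \<le> k \<and> A m i j \<noteq> -\<infinity>"
  by (auto simp: trellis_def)

lemma trellis_verts [simp]: "verts (trellis n A k) = {1..n} \<times> {0..k}"
  by (simp add: trellis_def)

lemma vwalk_snoc:
  "p \<noteq> [] \<Longrightarrow> vwalk (p @ [x]) G \<longleftrightarrow> vwalk p G \<and> x \<in> verts G \<and> (last p, x) \<in> arcs_ends G"
  by (auto simp: vwalk_def set_vwalk_arcs_snoc)

lemma trellis_weight_snoc:
  "p \<noteq> [] \<Longrightarrow>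
     trellis_weight A (p @ [x]) = trellis_weight A p + A (snd x) (fst (last p)) (fst x)"
  by (simp add: trellis_weight_def walk_weight_def vwalk_arcs_append case_prod_beta)

lemma trellis_weight_singleton [simp]: "trellis_weight A [x] = 0"
  by (simp add: trellis_weight_def)

lemma trellis_weight_split:
  "trellis_weight A (xs @ y # ys) = trellis_weight A (xs @ [y]) + trellis_weight A (y # ys)"
  unfolding trellis_weight_def by (rule walk_weight_split)

lemma trellis_walk_time:
  "vwalk p (trellis n A k) \<Longrightarrow> snd (last p) = snd (hd p) + (length p - 1)"
proof (induction rule: vwalk_induct)
  case (Cons u v es)
  then show ?case by (cases u; cases v) auto
qed auto

lemma trellis_walk_time_le:
  assumes "vwalk p (trellis n A k)"
  shows "snd (last p) \<le> k"
proof -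
  have "last p \<in> {1..n} \<times> {0..k}"
    using assms last_in_set[of p] unfolding vwalk_def trellis_verts by blast
  then show ?thesis by auto
qed

lemma finite_trellis_walks: "finite {p. vwalk p (trellis n A k) \<and> P p}"
proof (rule finite_subset)
  show "{p. vwalk p (trellis n A k) \<and> P p}
      \<subseteq> {p. set p \<subseteq> {1..n} \<times> {0..k} \<and> length p \<le> Suc k}"
  proof clarify
    fix p assume p: "vwalk p (trellis n A k)"
    then have "set p \<subseteq> {1..n} \<times> {0..k}" by (simp add: vwalk_def)
    moreover have "length p \<le> Suc k"
      using trellis_walk_time[OF p] trellis_walk_time_le[OF p] by linarith
    ultimately show "set p \<subseteq> {1..n} \<times> {0..k} \<and> length p \<le> Suc k" ..
  qed
qed (simp add: finite_lists_length_le)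

lemma trellis_weight_le_prod:
  assumes "vwalk p (trellis n A k)" "hd p = (i, 0)" "last p = (j, l)"
  shows "trellis_weight A p \<le> maxplus_prod n A l i j"
  using assms
proof (induction p arbitrary: j l rule: rev_induct)
  case Nil
  then show ?case by (simp add: vwalk_def)
next
  case (snoc x p)
  show ?case
  proof (cases "p = []")
    case True
    with snoc.prems show ?thesis by simp
  next
    case False
    obtain s m where last: "last p = (s, m)" by fastforce
    have walk: "vwalk p (trellis n A k)" and arc: "((s, m), (j, l)) \<in> arcs_ends (trellis n A k)"
      using snoc.prems False last by (simp_all add: vwalk_snoc del: trellis_arcs)
    from arc have s: "s \<in> {1..n}" and l: "l = Suc m" by simp_all
    have "hd p = (i, 0)" using snoc.prems(2) False by simp
    with snoc.IH walk last have IH: "trellis_weight A p \<le> maxplus_prod n A m i s" by blast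
    have "trellis_weight A (p @ [x]) = trellis_weight A p + A l s j"
      using False last snoc.prems(3) by (simp add: trellis_weight_snoc)
    also have "\<dots> \<le> maxplus_prod n A m i s + A l s j"
      using IH by (rule add_right_mono)
    also have "\<dots> \<le> maxplus_prod n A l i j"
      unfolding l maxplus_prod.simps maxplus_mult_def by (rule SUP_upper[OF s])
    finally show ?thesis .
  qed
qed

text \<open>
  The hypothesis excludes \<open>\<infinity>\<close> because \<open>-\<infinity> + \<infinity> = \<infinity>\<close> in \<^typ>\<open>ereal\<close>: with an infinite
  entry a sum other than \<open>-\<infinity>\<close> could come from a product entry \<open>-\<infinity>\<close>, to which no walk belongs.
\<close>

lemma prod_attained_by_trellis_walk:
  assumes "\<And>l u v. l \<in> {1..k} \<Longrightarrow> u \<in> {1..n} \<Longrightarrow> v \<in> {1..n} \<Longrightarrow> A l u v \<noteq> \<infinity>"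
    and "i \<in> {1..n}" "j \<in> {1..n}" "l \<le> k" "maxplus_prod n A l i j \<noteq> -\<infinity>"
  shows "maxplus_prod n A l i j \<noteq> \<infinity> \<and>
    (\<exists>p. vwalk p (trellis n A k) \<and> hd p = (i, 0) \<and> last p = (j, l) \<and>
         trellis_weight A p = maxplus_prod n A l i j)"
  using assms(3-)
proof (induction l arbitrary: j)
  case 0
  then have "i = j" by (auto split: if_splits)
  with assms(2) have "vwalk [(i, 0)] (trellis n A k)" by (simp add: vwalk_def)
  with \<open>i = j\<close> show ?case by (intro conjI exI[of _ "[(i, 0)]"]) simp_all
next
  case (Suc l)
  obtain s where s: "s \<in> {1..n}"
      and eq: "maxplus_prod n A (Suc l) i j = maxplus_prod n A l i s + A (Suc l) s j"
    unfolding maxplus_prod.simps maxplus_mult_def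
    using assms(2) by (elim ereal_SUP_attained[rotated 2]) auto
  have top: "A (Suc l) s j \<noteq> \<infinity>" using assms(1) s Suc.prems by simp
  have bot: "maxplus_prod n A l i s \<noteq> -\<infinity>"
    using Suc.prems(3) eq top by auto
  from Suc.IH[OF s _ bot] Suc.prems(2) obtain p where
    fin: "maxplus_prod n A l i s \<noteq> \<infinity>" and
    p: "vwalk p (trellis n A k)" "hd p = (i, 0)" "last p = (s, l)"
       "trellis_weight A p = maxplus_prod n A l i s"
    by auto
  have arc: "A (Suc l) s j \<noteq> -\<infinity>"
    using Suc.prems(3) eq fin by auto
  have ne: "p \<noteq> []" using p(1) by (simp add: vwalk_def)
  have "vwalk (p @ [(j, Suc l)]) (trellis n A k)"
    using p ne s arc Suc.prems(1,2) by (simp add: vwalk_snoc)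
  moreover have "trellis_weight A (p @ [(j, Suc l)]) = maxplus_prod n A (Suc l) i j"
    using p ne eq by (simp add: trellis_weight_snoc)
  ultimately show ?case
    using ne p(2) eq fin top by (intro conjI exI[of _ "p @ [(j, Suc l)]"]) simp_all
qed

lemma prod_le_if_trellis_walks_le:
  assumes "\<And>l u v. l \<in> {1..k} \<Longrightarrow> u \<in> {1..n} \<Longrightarrow> v \<in> {1..n} \<Longrightarrow> A l u v \<noteq> \<infinity>"
    and "i \<in> {1..n}" "j \<in> {1..n}"
    and "\<And>p. vwalk p (trellis n A k) \<Longrightarrow> hd p = (i, 0) \<Longrightarrow> last p = (j, k) \<Longrightarrow>
           trellis_weight A p \<le> b"
  shows "maxplus_prod n A k i j \<le> b"
proof (cases "maxplus_prod n A k i j = -\<infinity>")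
  case False
  from prod_attained_by_trellis_walk[OF assms(1-3) order_refl False] obtain p where
    "vwalk p (trellis n A k)" "hd p = (i, 0)" "last p = (j, k)"
    "trellis_weight A p = maxplus_prod n A k i j"
    by blast
  with assms(4)[of p] show ?thesis by simp
qed simp

section \<open>Initial and final walks\<close>

text \<open>
  Domination by \<open>S\<close> carries upper bounds from \<open>S\<close> over to walks on the trellis; the loops of
  weight 0 let a walk wait at node 1 for free.
\<close>

locale loop_dominated_product = unique_loop_matrix n S
  for n :: nat and S :: mpmat +
  fixes k :: nat and A :: "nat \<Rightarrow> mpmat"
  assumes dominated: "l \<in> {1..k} \<Longrightarrow> u \<in> {1..n} \<Longrightarrow> v \<in> {1..n} \<Longrightarrow> A l u v \<le> S u v"
    and loop: "l \<in> {1..k} \<Longrightarrow> A l 1 1 = 0"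
begin

lemma factor_not_top:
  assumes "l \<in> {1..k}" "u \<in> {1..n}" "v \<in> {1..n}"
  shows "A l u v \<noteq> \<infinity>"
  using dominated[OF assms] entry_not_top[OF assms(2,3)] by auto

lemma trellis_walk_projection:
  assumes "vwalk p (trellis n A k)"
  shows "vwalk (map fst p) (mat_digraph n S) \<and> trellis_weight A p \<le> mat_weight S (map fst p)"
  using assms
proof (induction rule: vwalk_induct)
  case (Base u)
  then show ?case by (cases u) (simp add: vwalk_mat_digraph_iff mat_weight_def)
next
  case (Cons u v es)
  obtain x l where u: "u = (x, l)" by fastforce
  obtain y m where v: "v = (y, m)" by fastforce
  from Cons.hyps(1) have arc: "x \<in> {1..n}" "y \<in> {1..n}" "m \<in> {1..k}" "A m x y \<noteq> -\<infinity>"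
    by (auto simp: u v)
  have le: "A m x y \<le> S x y" by (rule dominated[OF arc(3,1,2)])
  with arc(4) have "S x y \<noteq> -\<infinity>" by auto
  with Cons arc(1,2) have "vwalk (map fst (u # v # es)) (mat_digraph n S)"
    by (simp add: u v vwalk_mat_digraph_iff)
  moreover have "trellis_weight A (u # v # es) = A m x y + trellis_weight A (v # es)"
    by (simp add: u v trellis_weight_def walk_weight_def)
  moreover have "mat_weight S (map fst (u # v # es)) = S x y + mat_weight S (map fst (v # es))"
    by (simp add: u v mat_weight_def walk_weight_def)
  ultimately show ?case using add_mono[OF le conjunct2[OF Cons.IH]] by simp
qed

lemma trellis_weight_not_top:
  assumes "vwalk p (trellis n A k)"
  shows "trellis_weight A p \<noteq> \<infinity>"
proof -
  have "set (map fst p) \<subseteq> {1..n}" "trellis_weight A p \<le> mat_weight S (map fst p)"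
    using trellis_walk_projection[OF assms] by (simp_all add: vwalk_mat_digraph_iff)
  with mat_weight_not_top show ?thesis by (metis ereal_infty_less_eq(1))
qed

lemma trellis_weight_not_bot:
  assumes "vwalk p (trellis n A k)"
  shows "trellis_weight A p \<noteq> -\<infinity>"
  unfolding trellis_weight_def walk_weight_def
proof (rule sum_list_ereal_not_bot, rule notI)
  assume "-\<infinity> \<in> set (map (\<lambda>((i, l'), (j, l)). A l i j) (vwalk_arcs p))"
  then obtain u l' v l where e: "((u, l'), (v, l)) \<in> set (vwalk_arcs p)" "A l u v = -\<infinity>"
    by auto
  from e(1) assms have "((u, l'), (v, l)) \<in> arcs_ends (trellis n A k)"
    unfolding vwalk_def by blast
  with e(2) show False by simp
qed

lemma extend_by_loops:
  assumes "vwalk p (trellis n A k)" "last p = (1, m)" "m \<le> l" "l \<le> k"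
  shows "\<exists>q. vwalk q (trellis n A k) \<and> hd q = hd p \<and> last q = (1, l) \<and>
             trellis_weight A q = trellis_weight A p"
  using assms(3,4)
proof (induction l rule: dec_induct)
  case base
  with assms(1,2) show ?case by blast
next
  case (step l)
  then obtain q where q: "vwalk q (trellis n A k)" "hd q = hd p" "last q = (1, l)"
      "trellis_weight A q = trellis_weight A p"
    by auto
  have ne: "q \<noteq> []" using q(1) by (simp add: vwalk_def)
  have "vwalk (q @ [(1, Suc l)]) (trellis n A k)"
    using q ne step.prems one_in_nodes loop[of "Suc l"] by (simp add: vwalk_snoc)
  moreover have "trellis_weight A (q @ [(1, Suc l)]) = trellis_weight A p"
    using q ne step.prems loop[of "Suc l"] by (simp add: trellis_weight_snoc)
  ultimately show ?case using ne q(2) by (intro exI[of _ "q @ [(1, Suc l)]"]) simp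
qed

text \<open>
  If the initial walk ends no later than the final walk starts, the time between them is filled
  with loops at node 1.
\<close>

lemma initial_final_weight_le_prod:
  assumes p: "vwalk p (trellis n A k)" "hd p = (i, 0)" "last p = (1, m)"
    and q: "vwalk q (trellis n A k)" "hd q = (1, l)" "last q = (j, k)"
    and "m \<le> l"
  shows "trellis_weight A p + trellis_weight A q \<le> maxplus_prod n A k i j"
proof -
  have "l \<le> k" using trellis_walk_time[OF q(1)] q(2,3) by simp
  with extend_by_loops[OF p(1,3) \<open>m \<le> l\<close>] obtain r where
    r: "vwalk r (trellis n A k)" "hd r = (i, 0)" "last r = (1, l)" "trellis_weight A r = trellis_weight A p"
    using p(2) by auto
  have ne: "r \<noteq> []" "q \<noteq> []" using r(1) q(1) by (simp_all add: vwalk_def)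
  have join: "joinable r q" using ne r(3) q(2) by simp
  have "trellis_weight A (r \<oplus> q) \<le> maxplus_prod n A k i j"
  proof (rule trellis_weight_le_prod)
    show "vwalk (r \<oplus> q) (trellis n A k)" by (rule vwalk_joinI_vwalk[OF r(1) q(1) join])
    show "hd (r \<oplus> q) = (i, 0)" using join r(2) by (simp add: vwalk_join_hd)
    show "last (r \<oplus> q) = (j, k)" using join q(3) by (simp add: vwalk_join_last)
  qed
  moreover have "trellis_weight A (r \<oplus> q) = trellis_weight A r + trellis_weight A q"
    by (simp add: trellis_weight_def walk_weight_def vwalk_join_arcs[OF join])
  ultimately show ?thesis using r(4) by simp
qed

text \<open>
  Cut at the first and at the last visit to node 1. The middle piece projects to a closed walk of
  \<open>S\<close>, whose weight is at most 0.
\<close>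

lemma trellis_walk_through_1_weight_le:
  assumes p: "vwalk p (trellis n A k)" "hd p = (i, 0)" "last p = (j, k)"
    and visit: "\<exists>x\<in>set p. fst x = 1"
  shows "trellis_weight A p \<le> w_star n A k i + v_star n A k j"
proof -
  obtain xs u ys where u: "p = xs @ u # ys" "fst u = 1" "\<forall>x\<in>set xs. fst x \<noteq> 1"
    using split_list_first_prop[OF visit] by blast
  have visit': "\<exists>x\<in>set (u # ys). fst x = 1" using u(2) by simp
  obtain us v vs where v: "u # ys = us @ v # vs" "fst v = 1" "\<forall>x\<in>set vs. fst x \<noteq> 1"
    using split_list_last_prop[OF visit'] by blast
  have walk: "vwalk (u # ys) (trellis n A k)" "vwalk (xs @ [u]) (trellis n A k)"
    using p(1) u(1) vwalkI_append_r[of "u # ys" xs] vwalkI_append_l[of "xs @ [u]" ys] by simp_all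
  then have walk': "vwalk (v # vs) (trellis n A k)" "vwalk (us @ [v]) (trellis n A k)"
    using v(1) vwalkI_append_r[of "v # vs" us] vwalkI_append_l[of "us @ [v]" vs] by simp_all
  have "initial_walk n A k i (xs @ [u])"
    using walk(2) u p(2) trellis_walk_time_le[OF walk(2)] unfolding initial_walk_def
    by (cases xs; cases u) auto
  then have "trellis_weight A (xs @ [u]) \<le> w_star n A k i"
    unfolding w_star_def by (intro SUP_upper) simp
  moreover have "trellis_weight A (us @ [v]) \<le> 0"
  proof (cases us)
    case (Cons x us')
    then have "x = u" using v(1) by simp
    with Cons have "mat_cycle n S (map fst (us @ [v]))"
      using trellis_walk_projection[OF walk'(2)] u(2) v(2) by (simp add: mat_cycle_def)
    with closed_walk_weight_le_0 trellis_walk_projection[OF walk'(2)] show ?thesis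
      by (meson order_trans)
  qed simp
  moreover have "trellis_weight A (v # vs) \<le> v_star n A k j"
  proof -
    have "last (v # vs) = (j, k)" using p(3) u(1) v(1) by (metis last_appendR list.distinct(1))
    moreover have "snd v \<le> k"
      using trellis_walk_time[OF walk'(1)] trellis_walk_time_le[OF walk'(1)] by simp
    ultimately have "final_walk n A k j (v # vs)"
      using walk'(1) v(2,3) unfolding final_walk_def by (cases v) auto
    then show ?thesis unfolding v_star_def by (intro SUP_upper) simp
  qed
  ultimately have "trellis_weight A (xs @ [u]) + (trellis_weight A (us @ [v]) + trellis_weight A (v # vs))
      \<le> w_star n A k i + (0 + v_star n A k j)"
    by (intro add_mono)
  then show ?thesis
    using trellis_weight_split[of A xs u ys] trellis_weight_split[of A us v vs]
    by (simp add: u(1) v(1))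
qed

end

section \<open>Length bounds and the factorization\<close>

text \<open>
  Turns an upper bound on a weight into an upper bound on the number \<open>d\<close> of removed edges. The
  weight is split into \<open>x \<le> y\<close> so that \<open>y\<close> can be the weight of an actual walk while \<open>x\<close> may be
  \<open>-\<infinity>\<close>. For \<open>lam = -\<infinity>\<close> nothing can have been removed from a walk of weight above
  \<open>-\<infinity>\<close>, which matches the convention that the quotient is then 0.
\<close>

lemma excess_length_le_quot:
  fixes x y c lam :: ereal
  assumes "lam < 0" "\<bar>c\<bar> \<noteq> \<infinity>" "x \<noteq> \<infinity>" "x \<le> y" "y \<noteq> -\<infinity>" "y \<le> c + lam * ereal (real d)"
  shows "ereal (real d) \<le> quot (x - c) lam"
proof -
  obtain r where c: "c = ereal r" using assms(2) by (cases c) auto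
  show ?thesis
  proof (cases lam)
    case MInf
    have "d = 0"
    proof (rule ccontr)
      assume "d \<noteq> 0"
      then have "y \<le> -\<infinity>" using assms(6) by (simp add: MInf c)
      with assms(5) show False by simp
    qed
    then show ?thesis by (simp add: quot_def MInf)
  next
    case (real \<mu>)
    with assms(1) have neg: "\<mu> < 0" by simp
    show ?thesis
    proof (cases x)
      case MInf
      then show ?thesis by (simp add: quot_def c real)
    next
      case (real z)
      from assms(4,6) have "x \<le> c + lam * ereal (real d)" by (rule order_trans)
      then have "z - r \<le> \<mu> * real d" by (simp add: c real \<open>lam = ereal \<mu>\<close>)
      then have "real d \<le> (z - r) / \<mu>" using neg by (simp add: neg_le_divide_eq mult.commute)
      then show ?thesis using neg by (simp add: quot_def c real \<open>lam = ereal \<mu>\<close>)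
    qed (use assms(3) in simp)
  qed (use assms(1) in simp)
qed

context loop_dominated_product
begin

lemma w_star_attained:
  assumes "w_star n A k i \<noteq> -\<infinity>"
  obtains p where "initial_walk n A k i p" "trellis_weight A p = w_star n A k i"
proof -
  have "finite {p. initial_walk n A k i p}"
    unfolding initial_walk_def by (rule finite_trellis_walks)
  with assms that show thesis unfolding w_star_def by (metis ereal_SUP_attained_or_bot mem_Collect_eq)
qed

lemma v_star_attained:
  assumes "v_star n A k j \<noteq> -\<infinity>"
  obtains p where "final_walk n A k j p" "trellis_weight A p = v_star n A k j"
proof -
  have "finite {p. final_walk n A k j p}"
    unfolding final_walk_def by (rule finite_trellis_walks)
  with assms that show thesis unfolding v_star_def by (metis ereal_SUP_attained_or_bot mem_Collect_eq)
qed

lemma w_star_not_top: "w_star n A k i \<noteq> \<infinity>"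
proof
  assume top: "w_star n A k i = \<infinity>"
  then have "w_star n A k i \<noteq> -\<infinity>" by simp
  then obtain p where "initial_walk n A k i p" "trellis_weight A p = w_star n A k i"
    by (rule w_star_attained)
  with top trellis_weight_not_top show False by (simp add: initial_walk_def)
qed

lemma v_star_not_top: "v_star n A k j \<noteq> \<infinity>"
proof
  assume top: "v_star n A k j = \<infinity>"
  then have "v_star n A k j \<noteq> -\<infinity>" by simp
  then obtain p where "final_walk n A k j p" "trellis_weight A p = v_star n A k j"
    by (rule v_star_attained)
  with top trellis_weight_not_top show False by (simp add: final_walk_def)
qed

lemma w_star_1_le_0: "w_star n A k 1 \<le> 0"
  unfolding w_star_def
proof (rule SUP_least)
  fix p assume "p \<in> {p. initial_walk n A k 1 p}"
  then have p: "p \<noteq> []" "hd p = (1, 0)" "\<forall>x\<in>set (butlast p). fst x \<noteq> 1"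
    by (auto simp: initial_walk_def vwalk_def)
  then have "p = [(1, 0)]" by (cases p) (auto split: if_splits)
  then show "trellis_weight A p \<le> 0" by simp
qed

lemma v_star_1_le_0: "v_star n A k 1 \<le> 0"
  unfolding v_star_def
proof (rule SUP_least)
  fix p assume "p \<in> {p. final_walk n A k 1 p}"
  then have p: "p \<noteq> []" "last p = (1, k)" "\<forall>x\<in>set (tl p). fst x \<noteq> 1"
    by (auto simp: final_walk_def vwalk_def)
  have "tl p = []"
  proof (rule ccontr)
    assume ne: "tl p \<noteq> []"
    then have "last (tl p) \<in> set (tl p)" by (rule last_in_set)
    moreover have "last (tl p) = (1, k)" using ne p(2) by (simp add: last_tl)
    ultimately show False using p(3) by force
  qed
  then have "p = [hd p]" using p(1) by (cases p) simp_all
  then have "trellis_weight A p = 0" by (metis trellis_weight_singleton)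
  then show "trellis_weight A p \<le> 0" by simp
qed

text \<open>
  After the first visit to node 1 a walk to \<open>1:k\<close> gains nothing, and looping at node 1 loses
  nothing. Formally this is the case \<open>j = 1\<close> of the estimates for walks through node 1, with the
  trivial final walk \<open>[(1, k)]\<close>.
\<close>

lemma prod_to_1_eq_w_star:
  assumes "i \<in> {1..n}"
  shows "maxplus_prod n A k i 1 = w_star n A k i"
proof (rule antisym)
  show "maxplus_prod n A k i 1 \<le> w_star n A k i"
  proof (rule prod_le_if_trellis_walks_le[OF factor_not_top assms one_in_nodes])
    fix p assume p: "vwalk p (trellis n A k)" "hd p = (i, 0)" "last p = (1, k)"
    have "last p \<in> set p" using p(1) by (simp add: vwalk_def)
    then have "\<exists>x\<in>set p. fst x = 1" using p(3) by force
    with p have "trellis_weight A p \<le> w_star n A k i + v_star n A k 1"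
      by (rule trellis_walk_through_1_weight_le)
    also have "\<dots> \<le> w_star n A k i + 0" using v_star_1_le_0 by (rule add_left_mono)
    finally show "trellis_weight A p \<le> w_star n A k i" by simp
  qed
next
  show "w_star n A k i \<le> maxplus_prod n A k i 1"
    unfolding w_star_def
  proof (rule SUP_least)
    fix p assume "p \<in> {p. initial_walk n A k i p}"
    then obtain m where p: "vwalk p (trellis n A k)" "hd p = (i, 0)" "last p = (1, m)" "m \<le> k"
      by (auto simp: initial_walk_def)
    have "vwalk [(1, k)] (trellis n A k)" using one_in_nodes by (simp add: vwalk_def)
    from initial_final_weight_le_prod[OF p(1-3) this _ _ p(4)]
    show "trellis_weight A p \<le> maxplus_prod n A k i 1" by simp
  qed
qed

lemma prod_from_1_eq_v_star:
  assumes "j \<in> {1..n}"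
  shows "maxplus_prod n A k 1 j = v_star n A k j"
proof (rule antisym)
  show "maxplus_prod n A k 1 j \<le> v_star n A k j"
  proof (rule prod_le_if_trellis_walks_le[OF factor_not_top one_in_nodes assms])
    fix p assume p: "vwalk p (trellis n A k)" "hd p = (1, 0)" "last p = (j, k)"
    have "hd p \<in> set p" using p(1) by (simp add: vwalk_def)
    then have "\<exists>x\<in>set p. fst x = 1" using p(2) by force
    with p have "trellis_weight A p \<le> w_star n A k 1 + v_star n A k j"
      by (rule trellis_walk_through_1_weight_le)
    also have "\<dots> \<le> 0 + v_star n A k j" using w_star_1_le_0 by (rule add_right_mono)
    finally show "trellis_weight A p \<le> v_star n A k j" by simp
  qed
next
  show "v_star n A k j \<le> maxplus_prod n A k 1 j"
    unfolding v_star_def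
  proof (rule SUP_least)
    fix p assume "p \<in> {p. final_walk n A k j p}"
    then obtain l where p: "vwalk p (trellis n A k)" "hd p = (1, l)" "last p = (j, k)"
      by (auto simp: final_walk_def)
    have "vwalk [(1, 0)] (trellis n A k)" using one_in_nodes by (simp add: vwalk_def)
    from initial_final_weight_le_prod[OF this _ _ p le0]
    show "trellis_weight A p \<le> maxplus_prod n A k 1 j" by simp
  qed
qed

text \<open>
  The number \<open>d\<close> counts the edges on the removed cycles; what remains is a path of at most
  \<open>n - 1\<close> edges.
\<close>

lemma trellis_walk_weight_le_path_bound:
  assumes p: "vwalk p (trellis n A k)"
    and avoid: "(\<forall>x\<in>set (butlast p). fst x \<noteq> 1) \<or> (\<forall>x\<in>set (tl p). fst x \<noteq> 1)"
    and paths: "\<And>q. vpath q (mat_digraph n S) \<Longrightarrow> hd q = fst (hd p) \<Longrightarrow> last q = fst (last p) \<Longrightarrow>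
                  set q \<subseteq> fst ` set p \<Longrightarrow> mat_weight S q \<le> a"
  obtains d where "length p - 1 \<le> d + (n - 1)"
    "trellis_weight A p \<le> a + lambda_star n S * ereal (real d)"
proof -
  have ne: "p \<noteq> []" using p by (simp add: vwalk_def)
  note proj = trellis_walk_projection[OF p]
  have "1 \<notin> set (butlast (map fst p)) \<inter> set (tl (map fst p))"
    using avoid by (auto simp: map_butlast[symmetric] map_tl[symmetric])
  moreover have "mat_weight S q \<le> a"
    if "vpath q (mat_digraph n S)" "hd q = hd (map fst p)" "last q = last (map fst p)"
       "set q \<subseteq> set (map fst p)" for q
    using that ne by (intro paths) (simp_all add: hd_map last_map)
  ultimately obtain l where l: "l \<le> n - 1" "l \<le> length (map fst p) - 1"
    "mat_weight S (map fst p) \<le> a + lambda_star n S * ereal (real (length (map fst p) - 1 - l))"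
    using conjunct1[OF proj] walk_weight_le_path_bound by metis
  show thesis
  proof (rule that)
    show "length p - 1 \<le> (length p - 1 - l) + (n - 1)" using l(1,2) by simp
    show "trellis_weight A p \<le> a + lambda_star n S * ereal (real (length p - 1 - l))"
      using conjunct2[OF proj] l(3) by simp
  qed
qed

text \<open>
  A walk heavier than \<open>x\<close> would, by the path bound \<open>\<gamma>\<^sub>i\<^sub>j\<close>, have too few removable edges to reach
  length \<open>k\<close>.
\<close>

lemma avoiding_walk_weight_le:
  assumes p: "vwalk p (trellis n A k)" "hd p = (i, 0)" "last p = (j, k)"
    and avoid: "\<forall>x\<in>set p. fst x \<noteq> 1"
    and bound: "gamma_quot x (gamma n S i j) (lambda_star n S) + ereal (real n - 1) < ereal (real k)"
  shows "trellis_weight A p \<le> x"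
proof (rule ccontr)
  assume "\<not> trellis_weight A p \<le> x"
  then have less: "x < trellis_weight A p" by simp
  let ?g = "gamma n S i j" and ?lam = "lambda_star n S"
  have "mat_weight S q \<le> ?g"
    if "vpath q (mat_digraph n S)" "hd q = fst (hd p)" "last q = fst (last p)"
       "set q \<subseteq> fst ` set p" for q
  proof -
    have "1 \<notin> set q" using that(4) avoid by (metis imageE subsetD)
    then show ?thesis unfolding gamma_def using that(1-3) p(2,3) by (intro SUP_upper) simp
  qed
  moreover have "\<forall>x\<in>set (tl p). fst x \<noteq> 1" using avoid by (cases p) auto
  ultimately obtain d where d: "length p - 1 \<le> d + (n - 1)"
      "trellis_weight A p \<le> ?g + ?lam * ereal (real d)"
    using trellis_walk_weight_le_path_bound[OF p(1)] by metis
  have "length p - 1 = k" using trellis_walk_time[OF p(1)] p(2,3) by simp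
  note bot = trellis_weight_not_bot[OF p(1)]
  have "?lam * ereal (real d) \<le> 0"
    using less_imp_le[OF lambda_star_less_0] by (simp add: ereal_mult_le_0_iff)
  then have "?g + ?lam * ereal (real d) \<le> ?g + 0" by (rule add_left_mono)
  with d(2) have "trellis_weight A p \<le> ?g" by (metis add_0_right order_trans)
  with bot have g: "?g \<noteq> -\<infinity>" by (metis ereal_infty_less_eq(2))
  have "ereal (real d) \<le> quot (x - ?g) ?lam"
    using lambda_star_less_0 _ _ less_imp_le[OF less] bot d(2)
  proof (rule excess_length_le_quot)
    show "\<bar>?g\<bar> \<noteq> \<infinity>" using g gamma_not_top by auto
    show "x \<noteq> \<infinity>" using less by auto
  qed
  moreover have "ereal (real k) \<le> ereal (real d) + ereal (real n - 1)"
    using d(1) \<open>length p - 1 = k\<close> one_in_nodes by (simp add: of_nat_diff)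
  ultimately have "ereal (real k) \<le> quot (x - ?g) ?lam + ereal (real n - 1)"
    by (meson add_right_mono order_trans)
  with bound g show False by (simp add: gamma_quot_def)
qed

text \<open>
  The path bounds \<open>\<alpha>\<^sub>i\<close> and \<open>\<beta>\<^sub>j\<close> limit the total number of removable edges of the two walks, so
  their lengths \<open>m\<close> and \<open>k - l\<close> add up to less than \<open>k\<close>.
\<close>

lemma initial_and_final_walks_fit:
  assumes ij: "i \<in> {1..n}" "j \<in> {1..n}"
    and p: "initial_walk n A k i p" "last p = (1, m)"
    and q: "final_walk n A k j q" "hd q = (1, l)"
    and bound: "quot (trellis_weight A p - alpha n S i + trellis_weight A q - beta n S j)
        (lambda_star n S) + ereal (2 * (real n - 1)) < ereal (real k)"
  shows "m \<le> l"
proof -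
  let ?a = "alpha n S i" and ?b = "beta n S j" and ?lam = "lambda_star n S"
  let ?w = "trellis_weight A p" and ?v = "trellis_weight A q"
  have walks: "vwalk p (trellis n A k)" "vwalk q (trellis n A k)"
    and ends: "hd p = (i, 0)" "last q = (j, k)"
    using p(1) q(1) by (simp_all add: initial_walk_def final_walk_def)
  have "mat_weight S r \<le> ?a"
    if "vpath r (mat_digraph n S)" "hd r = fst (hd p)" "last r = fst (last p)" for r
    unfolding alpha_def using that p(2) ends(1) by (intro SUP_upper) auto
  moreover have "\<forall>x\<in>set (butlast p). fst x \<noteq> 1" using p(1) by (simp add: initial_walk_def)
  ultimately obtain d where d: "length p - 1 \<le> d + (n - 1)" "?w \<le> ?a + ?lam * ereal (real d)"
    using trellis_walk_weight_le_path_bound[OF walks(1)] by metis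
  have "mat_weight S r \<le> ?b"
    if "vpath r (mat_digraph n S)" "hd r = fst (hd q)" "last r = fst (last q)" for r
    unfolding beta_def using that q(2) ends(2) by (intro SUP_upper) auto
  moreover have "\<forall>x\<in>set (tl q). fst x \<noteq> 1" using q(1) by (simp add: final_walk_def)
  ultimately obtain e where e: "length q - 1 \<le> e + (n - 1)" "?v \<le> ?b + ?lam * ereal (real e)"
    using trellis_walk_weight_le_path_bound[OF walks(2)] by metis
  obtain a b where ab: "?a = ereal a" "?b = ereal b"
    using alpha_finite[OF ij(1)] beta_finite[OF ij(2)] by (cases ?a; cases ?b) auto
  obtain w v where wv: "?w = ereal w" "?v = ereal v"
    using walks[THEN trellis_weight_not_top] walks[THEN trellis_weight_not_bot]
    by (cases ?w; cases ?v) auto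
  have "?w + ?v \<le> (?a + ?lam * ereal (real d)) + (?b + ?lam * ereal (real e))"
    using d(2) e(2) by (rule add_mono)
  also have "\<dots> = (?a + ?b) + ?lam * (ereal (real d) + ereal (real e))"
    by (subst ereal_right_distrib) (simp_all add: ac_simps)
  also have "ereal (real d) + ereal (real e) = ereal (real (d + e))" by simp
  finally have "?w + ?v \<le> (?a + ?b) + ?lam * ereal (real (d + e))" .
  then have "ereal (real (d + e)) \<le> quot (?w + ?v - (?a + ?b)) ?lam"
    by (intro excess_length_le_quot[OF lambda_star_less_0 _ _ order_refl]) (simp_all add: ab wv)
  also have "?w + ?v - (?a + ?b) = ?w - ?a + ?v - ?b" by (simp add: ab wv)
  finally have "ereal (real (d + e)) + ereal (2 * (real n - 1)) < ereal (real k)"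
    using bound by (meson add_right_mono order_le_less_trans)
  then have "real d + real e + 2 * (real n - 1) < real k" by simp
  moreover have "m \<le> d + (n - 1)"
    using d(1) trellis_walk_time[OF walks(1)] p(2) ends(1) by simp
  moreover have "k \<le> l + (e + (n - 1))"
    using e(1) trellis_walk_time[OF walks(2)] q(2) ends(2) by simp
  ultimately show ?thesis using one_in_nodes by simp
qed

lemma prod_eq_w_star_plus_v_star:
  assumes ij: "i \<in> {1..n}" "j \<in> {1..n}"
    and avoiding: "gamma_quot (w_star n A k i + v_star n A k j) (gamma n S i j) (lambda_star n S)
        + ereal (real n - 1) < ereal (real k)"
    and fitting: "quot (w_star n A k i - alpha n S i + v_star n A k j - beta n S j) (lambda_star n S)
        + ereal (2 * (real n - 1)) < ereal (real k)"
  shows "maxplus_prod n A k i j = w_star n A k i + v_star n A k j"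
proof (rule antisym)
  let ?w = "w_star n A k i" and ?v = "v_star n A k j"
  show "maxplus_prod n A k i j \<le> ?w + ?v"
  proof (rule prod_le_if_trellis_walks_le[OF factor_not_top ij])
    fix p assume "vwalk p (trellis n A k)" "hd p = (i, 0)" "last p = (j, k)"
    then show "trellis_weight A p \<le> ?w + ?v"
      using trellis_walk_through_1_weight_le avoiding_walk_weight_le[OF _ _ _ _ avoiding] by metis
  qed
  show "?w + ?v \<le> maxplus_prod n A k i j"
  proof (cases "?w = -\<infinity> \<or> ?v = -\<infinity>")
    case True
    then have "?w + ?v = -\<infinity>"
      using w_star_not_top[of i] v_star_not_top[of j] by (cases ?w; cases ?v) auto
    then show ?thesis by (simp only: ereal_less_eq)
  next
    case False
    then obtain p q where p: "initial_walk n A k i p" "trellis_weight A p = ?w"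
        and q: "final_walk n A k j q" "trellis_weight A q = ?v"
      by (metis w_star_attained v_star_attained)
    obtain m l where ends: "last p = (1, m)" "hd q = (1, l)"
      using p(1) q(1) by (auto simp: initial_walk_def final_walk_def)
    have "m \<le> l"
      using initial_and_final_walks_fit[OF ij p(1) ends(1) q(1) ends(2)] fitting p(2) q(2)
      by simp
    with initial_final_weight_le_prod[OF _ _ ends(1) _ ends(2), of i j] p q show ?thesis
      by (simp add: initial_walk_def final_walk_def)
  qed
qed

end

text \<open>
  Geometric equivalence makes the supremum inherit the digraph, and hence the irreducibility, of
  each matrix in the set.
\<close>

lemma edge_set_sup_matrix:
  assumes "X \<in> \<X>" "\<forall>Y\<in>\<X>. geom_equivalent n X Y"
  shows "edge_set n (sup_matrix \<X>) = edge_set n X"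
proof -
  have "sup_matrix \<X> u v \<noteq> -\<infinity> \<longleftrightarrow> (\<exists>Y\<in>\<X>. Y u v \<noteq> -\<infinity>)" for u v
    by (auto simp: sup_matrix_def SUP_eq_iff bot_ereal_def[symmetric])
  then have "edge_set n (sup_matrix \<X>) = (\<Union>Y\<in>\<X>. edge_set n Y)"
    by (auto simp: edge_set_def)
  also have "\<dots> = edge_set n X"
  proof (rule SUP_eq_const)
    show "edge_set n Y = edge_set n X" if "Y \<in> \<X>" for Y
      using assms(2) that unfolding geom_equivalent_def by metis
  qed (use assms(1) in blast)
  finally show ?thesis .
qed

theorem theorem4p1:
  fixes n k i j :: nat
    and \<X> :: "mpmat set"
    and A :: "nat \<Rightarrow> mpmat"
  defines "S \<equiv> sup_matrix \<X>"
    and "\<Gamma> \<equiv> maxplus_prod n A k"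
  assumes nonempty: "\<X> \<noteq> {}"
    and matrices: "\<forall>X\<in>\<X>. maxplus_matrix n X"
    and A1_irreducible: "\<forall>X\<in>\<X>. mat_irreducible n X"
    and A1_equivalent: "\<forall>X\<in>\<X>. \<forall>Y\<in>\<X>. geom_equivalent n X Y"
    and A1_inf: "\<forall>X\<in>\<X>. geom_equivalent n (inf_matrix \<X>) X"
    and A2: "\<forall>X\<in>\<X>. unique_critical_loop_at_1 n X"
    and A3: "unique_critical_loop_at_1 n S"
    and A_in: "\<forall>l\<in>{1..k}. A l \<in> \<X>"
    and ij: "i \<in> {1..n}" "j \<in> {1..n}"
    and bound:
      "ereal (real k) >
         max (gamma_quot (w_star n A k i + v_star n A k j) (gamma n S i j) (lambda_star n S)
                + ereal (real n - 1))
             (quot (w_star n A k i - alpha n S i + v_star n A k j - beta n S j) (lambda_star n S)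
                + ereal (2 * (real n - 1)))"
  shows "\<Gamma> i j = \<Gamma> i 1 + \<Gamma> 1 j"
proof -
  obtain X where X: "X \<in> \<X>" using nonempty by blast
  interpret loop_dominated_product n S k A
  proof unfold_locales
    have "mat_digraph n S = mat_digraph n X"
      unfolding mat_digraph_def S_def using edge_set_sup_matrix[OF X] A1_equivalent X by simp
    then show "mat_irreducible n S"
      using A1_irreducible X by (simp add: mat_irreducible_def)
    show "unique_critical_loop_at_1 n S" by (rule A3)
    show "A l u v \<le> S u v" if "l \<in> {1..k}" for l u v
      unfolding S_def sup_matrix_def using A_in that by (intro SUP_upper) blast
    show "A l 1 1 = 0" if "l \<in> {1..k}" for l
    proof -
      have "mat_weight (A l) [1, 1] = 0"
        using A2 A_in that unfolding unique_critical_loop_at_1_def by blast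
      then show ?thesis by (simp add: mat_weight_def walk_weight_def)
    qed
  qed
  have "\<Gamma> i j = w_star n A k i + v_star n A k j"
    unfolding \<Gamma>_def using bound by (intro prod_eq_w_star_plus_v_star ij) simp_all
  then show ?thesis
    unfolding \<Gamma>_def by (simp only: prod_to_1_eq_w_star prod_from_1_eq_v_star ij)
qed

end
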